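(* Let $DOM(G;X)=\sum_{A\subseteq V(G):\,A\text{ is a dominating set of }G}X^{|A|}$ be the domination polynomial. (i) There is no graph property $\mathcal{C}$ such that $DOM(G;X)=\mathbf{P}^{ind}_{\mathcal{C}}(G;X)$ for all graphs $G$. (ii) There is no graph property $\mathcal{D}$ such that $DOM(G;X)=\mathbf{P}^{span}_{\mathcal{D}}(G;X)$ for all graphs $G$.
   Context: All graphs are finite without multiple edges. A set $A\subseteq V(G)$ is dominating if every vertex not in $A$ has a neighbor in $A$. A graph property is an isomorphism-closed class of graphs. $\mathbf{P}^{ind}_{\mathcal{C}}(G;X)=\sum_{A\subseteq V(G):G[A]\in\mathcal{C}}X^{|A|}$ with $G[A]$ the induced subgraph; $\mathbf{P}^{span}_{\mathcal{D}}(G;X)=\sum_{B\subseteq E(G):(V(G),B)\in\mathcal{D}}X^{|B|}$. *)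

theory Defs
  imports "HOL-Computational_Algebra.Polynomial"
begin

record 'a ugraph =
  verts :: "'a set"
  edges :: "'a set set"

text \<open>Finite undirected graphs without multiple edges. Loops are not excluded: a loop at \<open>u\<close> is
  the edge \<open>{u, u} = {u}\<close>. The null graph is a graph; it is the subgraph induced by the
  empty vertex set.\<close>

definition graph :: "'a ugraph \<Rightarrow> bool" where
  "graph G \<longleftrightarrow> finite (verts G) \<and>
     (\<forall>e\<in>edges G. \<exists>u\<in>verts G. \<exists>v\<in>verts G. e = {u, v})"

definition isomorphic :: "'a ugraph \<Rightarrow> 'a ugraph \<Rightarrow> bool" where
  "isomorphic G H \<longleftrightarrow> (\<exists>f. bij_betw f (verts G) (verts H) \<and>
     (\<forall>u\<in>verts G. \<forall>v\<in>verts G. {u, v} \<in> edges G \<longleftrightarrow> {f u, f v} \<in> edges H))"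

definition graph_property :: "'a ugraph set \<Rightarrow> bool" where
  "graph_property \<C> \<longleftrightarrow> (\<forall>G\<in>\<C>. graph G) \<and>
     (\<forall>G\<in>\<C>. \<forall>H. graph H \<and> isomorphic G H \<longrightarrow> H \<in> \<C>)"

definition induced_subgraph :: "'a ugraph \<Rightarrow> 'a set \<Rightarrow> 'a ugraph" where
  "induced_subgraph G A = \<lparr>verts = A, edges = {e \<in> edges G. e \<subseteq> A}\<rparr>"

definition spanning_subgraph :: "'a ugraph \<Rightarrow> 'a set set \<Rightarrow> 'a ugraph" where
  "spanning_subgraph G B = \<lparr>verts = verts G, edges = B\<rparr>"

definition dominating :: "'a ugraph \<Rightarrow> 'a set \<Rightarrow> bool" where
  "dominating G A \<longleftrightarrow> A \<subseteq> verts G \<and> (\<forall>v\<in>verts G - A. \<exists>u\<in>A. {u, v} \<in> edges G)"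

definition DOM :: "'a ugraph \<Rightarrow> int poly" where
  "DOM G = (\<Sum>A | A \<subseteq> verts G \<and> dominating G A. monom 1 (card A))"

definition P_ind :: "'a ugraph set \<Rightarrow> 'a ugraph \<Rightarrow> int poly" where
  "P_ind \<C> G = (\<Sum>A | A \<subseteq> verts G \<and> induced_subgraph G A \<in> \<C>. monom 1 (card A))"

definition P_span :: "'a ugraph set \<Rightarrow> 'a ugraph \<Rightarrow> int poly" where
  "P_span \<D> G = (\<Sum>B | B \<subseteq> edges G \<and> spanning_subgraph G B \<in> \<D>. monom 1 (card B))"

end

theory Submission imports Defs begin

text \<open>An edgeless graph on \<open>n\<close> vertices has domination polynomial \<open>X ^ n\<close>. If \<open>DOM\<close> were
  \<open>P_ind \<C>\<close>, then \<open>n = 1\<close> would force the one-vertex graph into \<open>\<C>\<close>, so that the polynomial of two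
  isolated vertices would have a nonzero coefficient at \<open>X\<close>. The second part fails already for
  \<open>n = 1\<close>, where a spanning generating function is constant.\<close>

definition edgeless :: "'a set \<Rightarrow> 'a ugraph" where
  "edgeless V = \<lparr>verts = V, edges = {}\<rparr>"

lemma verts_edgeless [simp]: "verts (edgeless V) = V"
  and edges_edgeless [simp]: "edges (edgeless V) = {}"
  by (simp_all add: edgeless_def)

lemma graph_edgeless [simp]: "graph (edgeless V) \<longleftrightarrow> finite V"
  by (simp add: graph_def)

lemma dominating_edgeless [simp]: "dominating (edgeless V) A \<longleftrightarrow> A = V"
  by (auto simp: dominating_def)

lemma induced_subgraph_edgeless [simp]: "induced_subgraph (edgeless V) A = edgeless A"
  by (simp add: induced_subgraph_def edgeless_def)

text \<open>An isolated vertex is dominated only by itself, so \<open>V\<close> is the sole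
  dominating set.\<close>

lemma DOM_edgeless: "DOM (edgeless V) = monom 1 (card V)"
proof -
  have "{A. A \<subseteq> V \<and> A = V} = {V}" by auto
  then show ?thesis by (simp add: DOM_def)
qed

lemma coeff_sum_monom_card:
  assumes "finite S"
  shows "coeff (\<Sum>A\<in>S. monom (1 :: int) (card A)) k = int (card {A \<in> S. card A = k})"
  using assms by (simp add: coeff_sum sum.If_cases Int_def)

lemma coeff_P_ind_edgeless:
  assumes "finite V"
  shows "coeff (P_ind \<C> (edgeless V)) k = int (card {A. A \<subseteq> V \<and> edgeless A \<in> \<C> \<and> card A = k})"
  using assms by (simp add: P_ind_def coeff_sum_monom_card conj_assoc)

text \<open>Induced subgraphs forget their host: \<open>edgeless {a}\<close> is counted at degree 1
  in both \<open>edgeless {a}\<close> and \<open>edgeless {a, b}\<close>, where \<open>DOM\<close>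
  has coefficients 1 and 0.\<close>

lemma P_ind_neq_DOM:
  fixes a b :: 'a
  assumes "a \<noteq> b"
  shows "\<exists>G :: 'a ugraph. graph G \<and> DOM G \<noteq> P_ind \<C> G"
proof (rule ccontr)
  assume "\<nexists>G :: 'a ugraph. graph G \<and> DOM G \<noteq> P_ind \<C> G"
  then have eq: "coeff (P_ind \<C> (edgeless V)) 1 = (if card V = 1 then 1 else 0)"
    if "finite V" for V :: "'a set"
    using that by (metis DOM_edgeless coeff_monom graph_edgeless)
  have "card {A. A \<subseteq> {a} \<and> edgeless A \<in> \<C> \<and> card A = 1} = 1"
    using eq[of "{a}"] by (simp add: coeff_P_ind_edgeless)
  then have "{A. A \<subseteq> {a} \<and> edgeless A \<in> \<C> \<and> card A = 1} \<noteq> {}"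
    by (metis card.empty zero_neq_one)
  then obtain A where "A \<subseteq> {a}" "edgeless A \<in> \<C>" "card A = 1"
    by blast
  then have "{a} \<in> {A. A \<subseteq> {a, b} \<and> edgeless A \<in> \<C> \<and> card A = 1}"
    by (auto simp: subset_singleton_iff)
  \<comment> \<open>Since \<open>card\<close> is 0 on infinite sets too, finiteness is what lets
    cardinality 0 mean emptiness.\<close>
  moreover have "finite {A. A \<subseteq> {a, b} \<and> edgeless A \<in> \<C> \<and> card A = 1}"
    by simp
  \<comment> \<open>As \<open>a\<close> and \<open>b\<close> differ, \<open>DOM\<close> is the
    monomial of degree 2 here.\<close>
  moreover have "card {A. A \<subseteq> {a, b} \<and> edgeless A \<in> \<C> \<and> card A = 1} = 0"
    using eq[of "{a, b}"] assms by (simp add: coeff_P_ind_edgeless)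
  ultimately show False
    by (metis card_0_eq empty_iff)
qed

text \<open>The only candidate edge set is \<open>{}\<close>, so the sum is 0 or 1.\<close>

lemma degree_P_span_edgeless: "degree (P_span \<D> (edgeless V)) = 0"
proof -
  have "degree (P_span \<D> (edgeless V)) \<le> 0"
    unfolding P_span_def
    by (intro degree_sum_le) (auto simp: degree_monom_eq)
  then show ?thesis by simp
qed

lemma P_span_neq_DOM: "\<exists>G :: 'a ugraph. graph G \<and> DOM G \<noteq> P_span \<D> G"
proof -
  fix a :: 'a
  have "degree (DOM (edgeless {a})) = 1"
    by (simp add: DOM_edgeless degree_monom_eq)
  then have "DOM (edgeless {a}) \<noteq> P_span \<D> (edgeless {a})"
    by (metis degree_P_span_edgeless zero_neq_one)
  then show ?thesis by (intro exI[of _ "edgeless {a}"]) simp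
qed

theorem theorem15:
  assumes "infinite (UNIV :: 'a set)"
  shows "(\<nexists>\<C> :: 'a ugraph set. graph_property \<C> \<and> (\<forall>G. graph G \<longrightarrow> DOM G = P_ind \<C> G)) \<and>
         (\<nexists>\<D> :: 'a ugraph set. graph_property \<D> \<and> (\<forall>G. graph G \<longrightarrow> DOM G = P_span \<D> G))"
proof -
  fix a :: 'a
  \<comment> \<open>The infinite vertex type supplies a second vertex.\<close>
  obtain b :: 'a where ab: "a \<noteq> b"
    using ex_new_if_finite[OF assms, of "{a}"] by (metis finite.emptyI finite.insertI singletonI)
  show ?thesis
    using P_ind_neq_DOM[OF ab] P_span_neq_DOM[where 'a = 'a] by blast
qed

end
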